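(* There exists a convex quadrilateral $R$ in the $xy$-plane which is bielliptic of class $\tau$ for some $\tau>0$. That is, there exists a bielliptic convex quadrilateral which is not bicentric.
   Context: Ellipses are nondegenerate and include circles. If an ellipse has semi-major axis length $a$ and semi-minor axis length $b$ ($a\ge b>0$), its eccentricity is $\sqrt{1-b^2/a^2}$. For a convex quadrilateral $R$, an ellipse is inscribed in $R$ if it lies in $R$ and is tangent to each of the four sides of $R$, and circumscribed about $R$ if it passes through the four vertices of $R$. Let $E_I$ denote the unique ellipse of minimal eccentricity among all ellipses inscribed in $R$, and let $E_O$ denote the unique ellipse of minimal eccentricity among all ellipses circumscribed about $R$. $R$ is called bielliptic if $E_I$ and $E_O$ have the same eccentricity; a bielliptic $R$ is said to be of class $\tau$, $0\le\tau<1$, if $E_I$ and $E_O$ each have eccentricity $\tau$. $R$ is cyclic if some circle passes through all its vertices, tangential if some circle can be inscribed in it, and bicentric if it is both cyclic and tangential. *)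

theory Defs
  imports "HOL-Analysis.Analysis"
begin

type_synonym plane = "real \<times> real"

text \<open>An ellipse is the curve itself, as a set of points; circles are the case \<open>a = b\<close>.\<close>

definition has_semi_axes :: "plane set \<Rightarrow> real \<Rightarrow> real \<Rightarrow> bool" where
  "has_semi_axes E a b \<longleftrightarrow> 0 < b \<and> b \<le> a \<and>
     (\<exists>c u v. norm u = 1 \<and> norm v = 1 \<and> u \<bullet> v = 0 \<and>
        E = {c + x *\<^sub>R u + y *\<^sub>R v | x y. (x / a)\<^sup>2 + (y / b)\<^sup>2 = 1})"

definition ellipse :: "plane set \<Rightarrow> bool" where
  "ellipse E \<longleftrightarrow> (\<exists>a b. has_semi_axes E a b)"

text \<open>The description is unique by \<open>eccentricity_eq\<close> below.\<close>

definition eccentricity :: "plane set \<Rightarrow> real" where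
  "eccentricity E = (THE e. \<exists>a b. has_semi_axes E a b \<and> e = sqrt (1 - b\<^sup>2 / a\<^sup>2))"

lemma has_semi_axes_norms:
  assumes "has_semi_axes E a b"
  obtains c where "\<And>p. p \<in> E \<Longrightarrow> b \<le> norm (p - c) \<and> norm (p - c) \<le> a"
    and "\<exists>p\<in>E. norm (p - c) = a" and "\<exists>p\<in>E. norm (p - c) = b"
    and "\<And>p. p \<in> E \<Longrightarrow> 2 *\<^sub>R c - p \<in> E"
proof -
  from assms obtain c u v where b: "0 < b" "b \<le> a" and o: "norm u = 1" "norm v = 1" "u \<bullet> v = 0"
    and E: "E = {c + x *\<^sub>R u + y *\<^sub>R v | x y. (x / a)\<^sup>2 + (y / b)\<^sup>2 = 1}"
    unfolding has_semi_axes_def by blast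
  have uu: "u \<bullet> u = 1" "v \<bullet> v = 1" "v \<bullet> u = 0"
    using o by (auto simp: norm_eq_1 inner_commute)
  have n: "(norm (x *\<^sub>R u + y *\<^sub>R v))\<^sup>2 = x\<^sup>2 + y\<^sup>2" for x y
    unfolding power2_norm_eq_inner using o uu
    by (simp add: inner_add_left inner_add_right power2_eq_square)
  have bounds: "b \<le> norm (p - c) \<and> norm (p - c) \<le> a" if "p \<in> E" for p
  proof -
    from that E obtain x y where p: "p = c + x *\<^sub>R u + y *\<^sub>R v" and e: "(x / a)\<^sup>2 + (y / b)\<^sup>2 = 1"
      by blast
    have pc: "(norm (p - c))\<^sup>2 = x\<^sup>2 + y\<^sup>2" using n[of x y] p by (simp add: add.assoc)
    define X Y where "X = (x / a)\<^sup>2" and "Y = (y / b)\<^sup>2"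
    have XY: "X \<ge> 0" "Y \<ge> 0" "X + Y = 1" "x\<^sup>2 = a\<^sup>2 * X" "y\<^sup>2 = b\<^sup>2 * Y"
      using b e by (auto simp: X_def Y_def power_divide)
    have ab: "b\<^sup>2 \<le> a\<^sup>2" using b by (simp add: power_mono)
    have "b\<^sup>2 = b\<^sup>2 * X + b\<^sup>2 * Y" "a\<^sup>2 = a\<^sup>2 * X + a\<^sup>2 * Y"
      using XY by (simp_all flip: distrib_left)
    moreover have "b\<^sup>2 * X \<le> a\<^sup>2 * X" "b\<^sup>2 * Y \<le> a\<^sup>2 * Y"
      using XY ab by (auto intro: mult_right_mono)
    ultimately have "b\<^sup>2 \<le> (norm (p - c))\<^sup>2" "(norm (p - c))\<^sup>2 \<le> a\<^sup>2"
      unfolding pc XY(4,5) by linarith+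
    then show ?thesis using b by (meson norm_ge_zero order.trans less_imp_le power2_le_imp_le)
  qed
  have "c + a *\<^sub>R u \<in> E" unfolding E using b
    by (intro CollectI exI[of _ a] exI[of _ 0]) auto
  then have 1: "\<exists>p\<in>E. norm (p - c) = a" using o b by (intro bexI[of _ "c + a *\<^sub>R u"]) auto
  have "c + b *\<^sub>R v \<in> E" unfolding E using b
    by (intro CollectI exI[of _ 0] exI[of _ b]) auto
  then have 2: "\<exists>p\<in>E. norm (p - c) = b" using o b by (intro bexI[of _ "c + b *\<^sub>R v"]) auto
  have 3: "2 *\<^sub>R c - p \<in> E" if "p \<in> E" for p
  proof -
    from that E obtain x y where p: "p = c + x *\<^sub>R u + y *\<^sub>R v" and e: "(x / a)\<^sup>2 + (y / b)\<^sup>2 = 1"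
      by blast
    have "2 *\<^sub>R c - p = c + (- x) *\<^sub>R u + (- y) *\<^sub>R v" unfolding p by (simp add: scaleR_2)
    moreover have "((- x) / a)\<^sup>2 + ((- y) / b)\<^sup>2 = 1" using e by simp
    ultimately show ?thesis unfolding E by blast
  qed
  show ?thesis using that[OF bounds 1 2 3] .
qed

lemma has_semi_axes_unique:
  assumes "has_semi_axes E a b" "has_semi_axes E a' b'"
  shows "a = a' \<and> b = b'"
proof -
  obtain c where c: "\<And>p. p \<in> E \<Longrightarrow> b \<le> norm (p - c) \<and> norm (p - c) \<le> a"
    "\<exists>p\<in>E. norm (p - c) = a" "\<exists>p\<in>E. norm (p - c) = b" "\<And>p. p \<in> E \<Longrightarrow> 2 *\<^sub>R c - p \<in> E"
    by (rule has_semi_axes_norms[OF assms(1)]) blast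
  obtain d where d: "\<And>p. p \<in> E \<Longrightarrow> b' \<le> norm (p - d) \<and> norm (p - d) \<le> a'"
    "\<exists>p\<in>E. norm (p - d) = a'" "\<exists>p\<in>E. norm (p - d) = b'" "\<And>p. p \<in> E \<Longrightarrow> 2 *\<^sub>R d - p \<in> E"
    by (rule has_semi_axes_norms[OF assms(2)]) blast
  obtain p where p: "p \<in> E" using c(2) by blast
  have tr: "p + real n *\<^sub>R (2 *\<^sub>R (d - c)) \<in> E" for n
  proof (induction n)
    case (Suc n)
    have "2 *\<^sub>R d - (2 *\<^sub>R c - (p + real n *\<^sub>R (2 *\<^sub>R (d - c)))) \<in> E"
      using c(4) d(4) Suc by blast
    then show ?case by (simp add: algebra_simps scaleR_2)
  qed (use p in simp)
  have "c = d"
  proof (rule ccontr)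
    assume "c \<noteq> d"
    then have pos: "norm (2 *\<^sub>R (d - c)) > 0" by simp
    obtain n where n: "real n * norm (2 *\<^sub>R (d - c)) > 2 * a"
      using ex_less_of_nat_mult[OF pos] by blast
    have "norm (real n *\<^sub>R (2 *\<^sub>R (d - c))) \<le> norm (p + real n *\<^sub>R (2 *\<^sub>R (d - c)) - c) + norm (p - c)"
      using norm_triangle_ineq4[of "p + real n *\<^sub>R (2 *\<^sub>R (d - c)) - c" "p - c"]
      by (simp add: algebra_simps)
    also have "\<dots> \<le> a + a" using c(1)[OF tr] c(1)[OF p] by (meson add_mono)
    finally show False using n by simp
  qed
  then have "a \<le> a'" "b' \<le> b" using c(2,3) d(1) by auto
  moreover have "a' \<le> a" "b \<le> b'" using c(1) d(2,3) \<open>c = d\<close> by auto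
  ultimately show ?thesis by simp
qed

lemma eccentricity_eq:
  assumes "has_semi_axes E a b"
  shows "eccentricity E = sqrt (1 - b\<^sup>2 / a\<^sup>2)"
  unfolding eccentricity_def using assms has_semi_axes_unique by blast

text \<open>A planar polytope with four extreme points is automatically two-dimensional.  Its vertices
  are its extreme points and its sides are its edges, the sets \<open>S\<close> with \<open>S edge_of R\<close>.\<close>

definition convex_quadrilateral :: "plane set \<Rightarrow> bool" where
  "convex_quadrilateral R \<longleftrightarrow> polytope R \<and> card {p. p extreme_point_of R} = 4"

text \<open>A line is tangent to an ellipse when they have exactly one common point; for a side, the
  point of contact must lie on the side and not merely on its extension.\<close>

definition tangent_to_side :: "plane set \<Rightarrow> plane set \<Rightarrow> bool" where
  "tangent_to_side E S \<longleftrightarrow> (\<exists>p\<in>S. E \<inter> affine hull S = {p})"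

definition inscribed :: "plane set \<Rightarrow> plane set \<Rightarrow> bool" where
  "inscribed R E \<longleftrightarrow> ellipse E \<and> E \<subseteq> R \<and> (\<forall>S. S edge_of R \<longrightarrow> tangent_to_side E S)"

definition circumscribed :: "plane set \<Rightarrow> plane set \<Rightarrow> bool" where
  "circumscribed R E \<longleftrightarrow> ellipse E \<and> (\<forall>p. p extreme_point_of R \<longrightarrow> p \<in> E)"

definition unique_min_eccentricity :: "(plane set \<Rightarrow> bool) \<Rightarrow> plane set \<Rightarrow> bool" where
  "unique_min_eccentricity P E \<longleftrightarrow>
     is_arg_min eccentricity P E \<and> (\<forall>E'. is_arg_min eccentricity P E' \<longrightarrow> E' = E)"

definition bielliptic :: "plane set \<Rightarrow> bool" where
  "bielliptic R \<longleftrightarrow> (\<exists>E\<^sub>I E\<^sub>O.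
     unique_min_eccentricity (inscribed R) E\<^sub>I \<and>
     unique_min_eccentricity (circumscribed R) E\<^sub>O \<and>
     eccentricity E\<^sub>I = eccentricity E\<^sub>O)"

definition bielliptic_of_class :: "plane set \<Rightarrow> real \<Rightarrow> bool" where
  "bielliptic_of_class R \<tau> \<longleftrightarrow> 0 \<le> \<tau> \<and> \<tau> < 1 \<and> (\<exists>E\<^sub>I E\<^sub>O.
     unique_min_eccentricity (inscribed R) E\<^sub>I \<and>
     unique_min_eccentricity (circumscribed R) E\<^sub>O \<and>
     eccentricity E\<^sub>I = \<tau> \<and> eccentricity E\<^sub>O = \<tau>)"

definition cyclic :: "plane set \<Rightarrow> bool" where
  "cyclic R \<longleftrightarrow> (\<exists>c r. 0 < r \<and> (\<forall>p. p extreme_point_of R \<longrightarrow> p \<in> sphere c r))"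

definition tangential :: "plane set \<Rightarrow> bool" where
  "tangential R \<longleftrightarrow> (\<exists>c r. 0 < r \<and> inscribed R (sphere c r))"

definition bicentric :: "plane set \<Rightarrow> bool" where
  "bicentric R \<longleftrightarrow> cyclic R \<and> tangential R"

end

theory Submission imports Defs begin

text \<open>
  For a parallelogram both extremal ellipses can be computed in closed form, which reduces
  biellipticity to one equation.  An ellipse with centre \<open>c\<close> is encoded by the symmetric positive
  definite matrix \<open>M\<close> with entries \<open>A, B, C\<close> for which \<open>w \<mapsto> sqrt (w \<bullet> M w)\<close> is the support
  function of the translate centred at the origin.  The eigenvalues of \<open>M\<close> are the squared
  semi-axes, so the eccentricity is a strictly increasing function of the anisotropy
  \<open>(tr M)\<^sup>2 / det M\<close>, a rational function of the entries
  (\<open>eccentricity_dual_conic_less_iff\<close>); minimizing eccentricity becomes minimizing this quotient.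

  Let a parallelogram centred at \<open>0\<close> have half side vectors \<open>e\<close> and \<open>f\<close>.  Inscribed ellipses are
  exactly those with centre \<open>0\<close> and support value \<open>1\<close> at the two side normals, each scaled to
  equal \<open>\<plusminus>1\<close> on its pair of sides; circumscribed ones have centre \<open>0\<close> and pass through \<open>e + f\<close> and \<open>e - f\<close>; either way a one-parameter family remains.
  With \<open>P = |e|\<^sup>2 + |f|\<^sup>2\<close>, \<open>Q = e \<bullet> f\<close> and \<open>D = (det (e, f))\<^sup>2\<close>, the minimal anisotropies are
  \<open>(P\<^sup>2 - 4 Q\<^sup>2) / D\<close> for the inscribed and \<open>4 |e|\<^sup>2 |f|\<^sup>2 / D\<close> for the circumscribed family.  They
  agree iff \<open>\<bar>|f|\<^sup>2 - |e|\<^sup>2\<bar> = 2 \<bar>Q\<bar>\<close>.  The choice \<open>e = (1, 0)\<close>, \<open>f = (2, 1)\<close> satisfies this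
  with \<open>Q \<noteq> 0\<close>, so the parallelogram with vertices \<open>\<plusminus>(3, 1)\<close>, \<open>\<plusminus>(1, 1)\<close> has both minima equal
  to \<open>20\<close>, whereas a circle has anisotropy \<open>4\<close>.  For this parallelogram
  \<open>inscribed_para_dual_conic\<close> and \<open>circumscribed_para_dual_conic\<close> determine the two families, and
  within each family the excess of the anisotropy over \<open>20\<close> is a perfect square over \<open>det M\<close>,
  which gives the minimum and its uniqueness.

  A bielliptic quadrilateral of positive class is never bicentric: a circumscribed circle would
  have eccentricity \<open>0\<close>, below the minimum.
\<close>

section \<open>Ellipses and their support matrices\<close>

text \<open>
  The matrix \<open>M\<close> with rows \<open>(A, B)\<close> and \<open>(B, C)\<close> describes the dual conic: the usual equation
  \<open>z \<bullet> M\<^sup>-\<^sup>1 z = 1\<close> for \<open>z = (x, y) - c\<close> is multiplied by \<open>det M\<close>, which avoids division.  Tangency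
  to a line is linear in \<open>M\<close>, and this is the reason for preferring \<open>M\<close> to \<open>M\<^sup>-\<^sup>1\<close>.
\<close>

definition dual_conic :: "plane \<Rightarrow> real \<Rightarrow> real \<Rightarrow> real \<Rightarrow> plane set" where
  "dual_conic c A B C = {(x, y) | x y.
     C * (x - fst c)\<^sup>2 - 2 * B * (x - fst c) * (y - snd c) + A * (y - snd c)\<^sup>2 = A * C - B\<^sup>2}"

definition pos_def :: "real \<Rightarrow> real \<Rightarrow> real \<Rightarrow> bool" where
  "pos_def A B C \<longleftrightarrow> 0 < A \<and> 0 < C \<and> 0 < A * C - B\<^sup>2"

definition anisotropy :: "real \<Rightarrow> real \<Rightarrow> real \<Rightarrow> real" where
  "anisotropy A B C = (A + C)\<^sup>2 / (A * C - B\<^sup>2)"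

lemma mem_dual_conic:
  "(x, y) \<in> dual_conic c A B C \<longleftrightarrow>
     C * (x - fst c)\<^sup>2 - 2 * B * (x - fst c) * (y - snd c) + A * (y - snd c)\<^sup>2 = A * C - B\<^sup>2"
  by (simp add: dual_conic_def)

text \<open>
  In the plane the second axis direction is the first one turned by a right angle, up to the sign
  \<open>D\<close>.  This removes two of the four coordinates of the axes from all later computations.
\<close>

lemma orthonormal_pair_plane:
  fixes u1 u2 v1 v2 :: real
  assumes "u1\<^sup>2 + u2\<^sup>2 = 1" "v1\<^sup>2 + v2\<^sup>2 = 1" "u1 * v1 + u2 * v2 = 0"
  obtains D where "D\<^sup>2 = 1" "v1 = - D * u2" "v2 = D * u1"
proof
  let ?D = "u1 * v2 - u2 * v1"
  have "?D\<^sup>2 = (u1\<^sup>2 + u2\<^sup>2) * (v1\<^sup>2 + v2\<^sup>2) - (u1 * v1 + u2 * v2)\<^sup>2"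
    by (simp add: power2_eq_square algebra_simps)
  then show "?D\<^sup>2 = 1" using assms by simp
  have "- ?D * u2 = v1 * (u1\<^sup>2 + u2\<^sup>2) - u1 * (u1 * v1 + u2 * v2)"
    by (simp add: power2_eq_square algebra_simps)
  then show "v1 = - ?D * u2" using assms by simp
  have "?D * u1 = v2 * (u1\<^sup>2 + u2\<^sup>2) - u2 * (u1 * v1 + u2 * v2)"
    by (simp add: power2_eq_square algebra_simps)
  then show "v2 = ?D * u1" using assms by simp
qed

text \<open>
  The right-hand side is the dual conic of \<open>a\<^sup>2 u u\<^sup>T + b\<^sup>2 v v\<^sup>T\<close> with \<open>u = (u1, u2)\<close> and \<open>v\<close>
  orthogonal to \<open>u\<close>.  In the coordinates along \<open>u\<close> and \<open>v\<close> its equation is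
  \<open>a\<^sup>2 y\<^sup>2 + b\<^sup>2 x\<^sup>2 = a\<^sup>2 b\<^sup>2\<close>.
\<close>

lemma axes_parametrization_eq_dual_conic:
  fixes a b D u1 u2 :: real and c :: plane
  assumes ab: "0 < b" "0 < a" and u: "u1\<^sup>2 + u2\<^sup>2 = 1" and D: "D\<^sup>2 = 1"
  shows "{c + x *\<^sub>R (u1, u2) + y *\<^sub>R (- D * u2, D * u1) | x y. (x / a)\<^sup>2 + (y / b)\<^sup>2 = 1}
     = dual_conic c (a\<^sup>2 * u1\<^sup>2 + b\<^sup>2 * u2\<^sup>2) ((a\<^sup>2 - b\<^sup>2) * u1 * u2) (a\<^sup>2 * u2\<^sup>2 + b\<^sup>2 * u1\<^sup>2)"
    (is "?L = ?R")
proof -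
  let ?A = "a\<^sup>2 * u1\<^sup>2 + b\<^sup>2 * u2\<^sup>2" and ?B = "(a\<^sup>2 - b\<^sup>2) * u1 * u2"
    and ?C = "a\<^sup>2 * u2\<^sup>2 + b\<^sup>2 * u1\<^sup>2"
  have det: "?A * ?C - ?B\<^sup>2 = a\<^sup>2 * b\<^sup>2"
  proof -
    have "?A * ?C - ?B\<^sup>2 = a\<^sup>2 * b\<^sup>2 * (u1\<^sup>2 + u2\<^sup>2)\<^sup>2" by algebra
    then show ?thesis using u by simp
  qed
  have form: "?C * X\<^sup>2 - 2 * ?B * X * Y + ?A * Y\<^sup>2
      = a\<^sup>2 * (u1 * Y - u2 * X)\<^sup>2 + b\<^sup>2 * (u1 * X + u2 * Y)\<^sup>2" for X Y
    by algebra
  have unit: "(x / a)\<^sup>2 + (y / b)\<^sup>2 = 1 \<longleftrightarrow> a\<^sup>2 * y\<^sup>2 + b\<^sup>2 * x\<^sup>2 = a\<^sup>2 * b\<^sup>2" for x y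
    using ab by (auto simp: field_simps power_divide)
  have *: "(X + fst c, Y + snd c) \<in> ?L \<longleftrightarrow> a\<^sup>2 * (u1 * Y - u2 * X)\<^sup>2 + b\<^sup>2 * (u1 * X + u2 * Y)\<^sup>2 = a\<^sup>2 * b\<^sup>2"
    (is "?M \<longleftrightarrow> ?Q") for X Y
  proof
    assume ?M
    then obtain x y where xy: "a\<^sup>2 * y\<^sup>2 + b\<^sup>2 * x\<^sup>2 = a\<^sup>2 * b\<^sup>2"
      and X: "X = x * u1 - y * D * u2" and Y: "Y = x * u2 + y * D * u1"
      unfolding unit by (cases c) auto
    have "u1 * X + u2 * Y = x * (u1\<^sup>2 + u2\<^sup>2)" "u1 * Y - u2 * X = y * D * (u1\<^sup>2 + u2\<^sup>2)"
      unfolding X Y by (simp_all add: power2_eq_square algebra_simps)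
    then show ?Q using xy u D by (simp add: power_mult_distrib)
  next
    assume ?Q
    define x y where "x = u1 * X + u2 * Y" and "y = D * (u1 * Y - u2 * X)"
    have "y * D = D\<^sup>2 * (u1 * Y - u2 * X)" by (simp add: y_def power2_eq_square)
    then have yD: "y * D = u1 * Y - u2 * X" using D by simp
    have "x * u1 - (y * D) * u2 = X * (u1\<^sup>2 + u2\<^sup>2)" "x * u2 + (y * D) * u1 = Y * (u1\<^sup>2 + u2\<^sup>2)"
      unfolding yD x_def by (simp_all add: power2_eq_square algebra_simps)
    then have "(X + fst c, Y + snd c) = c + x *\<^sub>R (u1, u2) + y *\<^sub>R (- D * u2, D * u1)"
      using u by (cases c) (simp add: mult.assoc)
    moreover have "(x / a)\<^sup>2 + (y / b)\<^sup>2 = 1"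
      unfolding unit using \<open>?Q\<close> D by (simp add: x_def y_def power_mult_distrib)
    ultimately show ?M by blast
  qed
  have "(x, y) \<in> ?L \<longleftrightarrow> (x, y) \<in> ?R" for x y
    using *[of "x - fst c" "y - snd c"] unfolding mem_dual_conic det form by simp
  then show ?thesis by auto
qed

lemma has_semi_axes_iff_dual_conic:
  "has_semi_axes E a b \<longleftrightarrow> 0 < b \<and> b \<le> a \<and> (\<exists>c u1 u2. u1\<^sup>2 + u2\<^sup>2 = 1 \<and>
     E = dual_conic c (a\<^sup>2 * u1\<^sup>2 + b\<^sup>2 * u2\<^sup>2) ((a\<^sup>2 - b\<^sup>2) * u1 * u2) (a\<^sup>2 * u2\<^sup>2 + b\<^sup>2 * u1\<^sup>2))"
    (is "?L \<longleftrightarrow> ?R")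
proof
  assume ?L
  then obtain c u v where ab: "0 < b" "b \<le> a" and o: "norm u = 1" "norm v = 1" "u \<bullet> v = 0"
    and E: "E = {c + x *\<^sub>R u + y *\<^sub>R v | x y. (x / a)\<^sup>2 + (y / b)\<^sup>2 = 1}"
    unfolding has_semi_axes_def by blast
  obtain u1 u2 v1 v2 where uv: "u = (u1, u2)" "v = (v1, v2)" by (cases u, cases v) auto
  have u1: "u1\<^sup>2 + u2\<^sup>2 = 1" "v1\<^sup>2 + v2\<^sup>2 = 1" "u1 * v1 + u2 * v2 = 0"
    using o by (simp_all add: uv norm_Pair)
  then obtain D where D: "D\<^sup>2 = 1" "v1 = - D * u2" "v2 = D * u1"
    by (rule orthonormal_pair_plane)
  have "0 < a" using ab by simp
  note axes_parametrization_eq_dual_conic[OF ab(1) this u1(1) D(1), of c, folded D(2,3) uv, folded E]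
  then show ?R using ab u1 by blast
next
  assume ?R
  then obtain c u1 u2 where ab: "0 < b" "b \<le> a" and u: "u1\<^sup>2 + u2\<^sup>2 = 1"
    and E: "E = dual_conic c (a\<^sup>2 * u1\<^sup>2 + b\<^sup>2 * u2\<^sup>2) ((a\<^sup>2 - b\<^sup>2) * u1 * u2) (a\<^sup>2 * u2\<^sup>2 + b\<^sup>2 * u1\<^sup>2)"
    by blast
  have "0 < a" using ab by simp
  note axes_parametrization_eq_dual_conic[OF ab(1) this u, of 1 c, folded E]
  moreover have "norm (u1, u2) = 1" "norm (- 1 * u2, 1 * u1) = 1" "(u1, u2) \<bullet> (- 1 * u2, 1 * u1) = 0"
    using u by (simp_all add: norm_Pair add.commute)
  ultimately show ?L unfolding has_semi_axes_def using ab
    by (intro conjI exI[of _ c] exI[of _ "(u1, u2)"] exI[of _ "(- 1 * u2, 1 * u1)"]) simp_all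
qed

lemma dual_conic_of_semi_axes:
  assumes "has_semi_axes E a b"
  obtains c A B C where "E = dual_conic c A B C" "pos_def A B C"
    "A + C = a\<^sup>2 + b\<^sup>2" "A * C - B\<^sup>2 = a\<^sup>2 * b\<^sup>2"
proof -
  from assms obtain c u1 u2 where ab: "0 < b" "b \<le> a" and u: "u1\<^sup>2 + u2\<^sup>2 = 1"
    and E: "E = dual_conic c (a\<^sup>2 * u1\<^sup>2 + b\<^sup>2 * u2\<^sup>2) ((a\<^sup>2 - b\<^sup>2) * u1 * u2) (a\<^sup>2 * u2\<^sup>2 + b\<^sup>2 * u1\<^sup>2)"
      (is "E = dual_conic c ?A ?B ?C")
    unfolding has_semi_axes_iff_dual_conic by blast
  have "?A + ?C = (a\<^sup>2 + b\<^sup>2) * (u1\<^sup>2 + u2\<^sup>2)" "?A * ?C - ?B\<^sup>2 = a\<^sup>2 * b\<^sup>2 * (u1\<^sup>2 + u2\<^sup>2)\<^sup>2"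
    by algebra+
  then have s: "?A + ?C = a\<^sup>2 + b\<^sup>2" "?A * ?C - ?B\<^sup>2 = a\<^sup>2 * b\<^sup>2" using u by simp_all
  have "b\<^sup>2 * u1\<^sup>2 + b\<^sup>2 * u2\<^sup>2 = b\<^sup>2" using u by (simp flip: distrib_left)
  moreover have "b\<^sup>2 * u1\<^sup>2 \<le> a\<^sup>2 * u1\<^sup>2" "b\<^sup>2 * u2\<^sup>2 \<le> a\<^sup>2 * u2\<^sup>2" "0 < b\<^sup>2"
    using ab by (auto intro!: mult_right_mono power_mono)
  ultimately have "0 < ?A" "0 < ?C" by linarith+
  then have "pos_def ?A ?B ?C" unfolding pos_def_def s(2) using ab by simp
  then show ?thesis using that E s by blast
qed

text \<open>
  Diagonalization of a symmetric matrix of size two: in polar form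
  \<open>((A - C) / 2, B) = \<rho> (cos 2\<theta>, sin 2\<theta>)\<close>, the angle \<open>\<theta>\<close> is the direction of the major axis and
  \<open>(A + C) / 2 \<plusminus> \<rho>\<close> are the eigenvalues, that is, the squared semi-axes.  Circles are the case
  \<open>\<rho> = 0\<close>, where any \<open>\<theta>\<close> serves.
\<close>

lemma semi_axes_of_dual_conic:
  assumes "pos_def A B C"
  obtains a b where "has_semi_axes (dual_conic c A B C) a b"
    "A + C = a\<^sup>2 + b\<^sup>2" "A * C - B\<^sup>2 = a\<^sup>2 * b\<^sup>2"
proof -
  define \<rho> where "\<rho> = cmod (Complex ((A - C) / 2) B)"
  define \<theta> where "\<theta> = Arg (Complex ((A - C) / 2) B) / 2"
  have "Complex ((A - C) / 2) B = rcis \<rho> (2 * \<theta>)"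
    by (simp add: \<rho>_def \<theta>_def rcis_cmod_Arg)
  then have "(A - C) / 2 = \<rho> * cos (2 * \<theta>)" and B: "B = \<rho> * sin (2 * \<theta>)"
    by (metis Re_rcis complex.sel(1)) (metis Im_rcis complex.sel(2) \<open>Complex _ B = _\<close>)
  then have AC: "A - C = 2 * \<rho> * cos (2 * \<theta>)" by simp
  have \<rho>2: "\<rho>\<^sup>2 = ((A - C) / 2)\<^sup>2 + B\<^sup>2" by (simp add: \<rho>_def cmod_power2)
  have \<rho>0: "0 \<le> \<rho>" by (simp add: \<rho>_def)
  have p: "0 < A + C" "0 < A * C - B\<^sup>2" using assms by (auto simp: pos_def_def)
  have "\<rho>\<^sup>2 < ((A + C) / 2)\<^sup>2" unfolding \<rho>2 using p by (simp add: power2_eq_square field_simps)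
  then have lt: "\<rho> < (A + C) / 2" using p by (intro power_less_imp_less_base[of \<rho> 2]) auto
  define a b where "a = sqrt ((A + C) / 2 + \<rho>)" and "b = sqrt ((A + C) / 2 - \<rho>)"
  have ab2: "a\<^sup>2 = (A + C) / 2 + \<rho>" "b\<^sup>2 = (A + C) / 2 - \<rho>" using lt \<rho>0 p by (simp_all add: a_def b_def)
  have u: "(cos \<theta>)\<^sup>2 + (sin \<theta>)\<^sup>2 = 1" by simp
  have split: "(m + r) * X + (m - r) * Y = m * (X + Y) + r * (X - Y)"
    "(m + r) * Y + (m - r) * X = m * (X + Y) - r * (X - Y)" for m r X Y :: real
    by algebra+
  have "a\<^sup>2 * (cos \<theta>)\<^sup>2 + b\<^sup>2 * (sin \<theta>)\<^sup>2 = (A + C) / 2 * ((cos \<theta>)\<^sup>2 + (sin \<theta>)\<^sup>2) + \<rho> * cos (2 * \<theta>)"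
    unfolding ab2 cos_double by (rule split)
  then have eA: "A = a\<^sup>2 * (cos \<theta>)\<^sup>2 + b\<^sup>2 * (sin \<theta>)\<^sup>2" using AC unfolding u by (simp add: field_simps)
  have "a\<^sup>2 * (sin \<theta>)\<^sup>2 + b\<^sup>2 * (cos \<theta>)\<^sup>2 = (A + C) / 2 * ((cos \<theta>)\<^sup>2 + (sin \<theta>)\<^sup>2) - \<rho> * cos (2 * \<theta>)"
    unfolding ab2 cos_double by (rule split)
  then have eC: "C = a\<^sup>2 * (sin \<theta>)\<^sup>2 + b\<^sup>2 * (cos \<theta>)\<^sup>2" using AC unfolding u by (simp add: field_simps)
  have eB: "B = (a\<^sup>2 - b\<^sup>2) * cos \<theta> * sin \<theta>" unfolding ab2 B sin_double by simp
  have "0 < b" "b \<le> a" using lt \<rho>0 by (simp_all add: a_def b_def)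
  then have "has_semi_axes (dual_conic c A B C) a b"
    unfolding has_semi_axes_iff_dual_conic using eA eB eC u by blast
  moreover have "A + C = a\<^sup>2 + b\<^sup>2" unfolding ab2 by simp
  moreover have "a\<^sup>2 * b\<^sup>2 = ((A + C) / 2)\<^sup>2 - \<rho>\<^sup>2" unfolding ab2 by (simp add: power2_eq_square algebra_simps)
  then have "A * C - B\<^sup>2 = a\<^sup>2 * b\<^sup>2" unfolding \<rho>2 by (simp add: power2_eq_square field_simps)
  ultimately show ?thesis using that by blast
qed

section \<open>Eccentricity as a function of the anisotropy\<close>

lemma ellipse_dual_conic: "pos_def A B C \<Longrightarrow> ellipse (dual_conic c A B C)"
  unfolding ellipse_def by (erule semi_axes_of_dual_conic[where c = c]) blast

lemma ellipse_eq_dual_conic: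
  assumes "ellipse E"
  obtains c A B C where "E = dual_conic c A B C" "pos_def A B C"
proof -
  from assms obtain a b where "has_semi_axes E a b" unfolding ellipse_def by blast
  then show ?thesis by (rule dual_conic_of_semi_axes) (rule that)
qed

text \<open>
  With \<open>r = b\<^sup>2 / a\<^sup>2 \<le> 1\<close> the eccentricity is \<open>sqrt (1 - r)\<close> and the anisotropy is \<open>r + 1 / r + 2\<close>;
  both decrease strictly with \<open>r\<close>.
\<close>

lemma eccentricity_dual_conic_less_iff:
  assumes "pos_def A B C" "pos_def A' B' C'"
  shows "eccentricity (dual_conic c A B C) < eccentricity (dual_conic c' A' B' C') \<longleftrightarrow>
    anisotropy A B C < anisotropy A' B' C'"
proof -
  obtain a b where s: "has_semi_axes (dual_conic c A B C) a b" "A + C = a\<^sup>2 + b\<^sup>2" "A * C - B\<^sup>2 = a\<^sup>2 * b\<^sup>2"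
    using semi_axes_of_dual_conic[OF assms(1)] .
  obtain a' b' where s': "has_semi_axes (dual_conic c' A' B' C') a' b'"
    "A' + C' = a'\<^sup>2 + b'\<^sup>2" "A' * C' - B'\<^sup>2 = a'\<^sup>2 * b'\<^sup>2"
    using semi_axes_of_dual_conic[OF assms(2)] .
  define r r' where "r = b\<^sup>2 / a\<^sup>2" and "r' = b'\<^sup>2 / a'\<^sup>2"
  have p: "0 < b" "b \<le> a" "0 < b'" "b' \<le> a'" using s(1) s'(1) by (auto simp: has_semi_axes_def)
  then have r: "0 < r" "r \<le> 1" "0 < r'" "r' \<le> 1" by (simp_all add: r_def r'_def power_mono)
  have t: "anisotropy A B C = r + 1 / r + 2" "anisotropy A' B' C' = r' + 1 / r' + 2"
    unfolding anisotropy_def s s' using p by (simp_all add: r_def r'_def power2_eq_square field_simps)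
  have d: "r' + 1 / r' - (r + 1 / r) = (r - r') * (1 / (r * r') - 1)"
    using r by (simp add: field_simps)
  have "r + 1 / r < r' + 1 / r' \<longleftrightarrow> r' < r"
  proof
    assume "r' < r"
    then have "r * r' < 1" using r by (metis less_le_trans mult_less_cancel_left2 order_less_imp_le mult_le_one linorder_not_le)
    then have "0 < (r - r') * (1 / (r * r') - 1)" using \<open>r' < r\<close> r by simp
    then show "r + 1 / r < r' + 1 / r'" using d by simp
  next
    assume lt: "r + 1 / r < r' + 1 / r'"
    have "0 \<le> 1 / (r * r') - 1" using r by (simp add: mult_le_one)
    show "r' < r"
    proof (rule ccontr)
      assume "\<not> r' < r"
      then have "(r - r') * (1 / (r * r') - 1) \<le> 0"
        using \<open>0 \<le> 1 / (r * r') - 1\<close> by (simp add: mult_nonpos_nonneg)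
      then show False using d lt by simp
    qed
  qed
  then show ?thesis
    unfolding t eccentricity_eq[OF s(1)] eccentricity_eq[OF s'(1)] by (simp add: r_def r'_def)
qed

lemma eccentricity_dual_conic_eq:
  assumes "pos_def A B C" "pos_def A' B' C'" "anisotropy A B C = anisotropy A' B' C'"
  shows "eccentricity (dual_conic c A B C) = eccentricity (dual_conic c' A' B' C')"
  using eccentricity_dual_conic_less_iff[OF assms(1,2)] eccentricity_dual_conic_less_iff[OF assms(2,1)]
    assms(3) by (metis linorder_less_linear order_less_irrefl)

lemma eccentricity_less_1:
  assumes "ellipse E" shows "eccentricity E < 1"
proof -
  from assms obtain a b where "has_semi_axes E a b" unfolding ellipse_def by blast
  then show ?thesis by (auto simp: eccentricity_eq has_semi_axes_def)
qed

text \<open>The value \<open>4\<close> is the anisotropy of a circle.\<close>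

lemma eccentricity_dual_conic_pos:
  assumes "pos_def A B C" "4 < anisotropy A B C"
  shows "0 < eccentricity (dual_conic c A B C)"
proof -
  obtain a b where s: "has_semi_axes (dual_conic c A B C) a b" "A + C = a\<^sup>2 + b\<^sup>2" "A * C - B\<^sup>2 = a\<^sup>2 * b\<^sup>2"
    using semi_axes_of_dual_conic[OF assms(1)] .
  then have p: "0 < b" "b \<le> a" by (auto simp: has_semi_axes_def)
  have "a \<noteq> b" using assms(2) p unfolding anisotropy_def s by (auto simp: power2_eq_square)
  then have "b\<^sup>2 < a\<^sup>2" using p by (intro power_strict_mono) auto
  then show ?thesis unfolding eccentricity_eq[OF s(1)] using p by simp
qed

lemma sphere_has_semi_axes:
  fixes c :: plane
  assumes "0 < r" shows "has_semi_axes (sphere c r) r r"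
proof -
  have r0: "r\<^sup>2 \<noteq> 0" using assms by simp
  have "(x, y) \<in> sphere c r \<longleftrightarrow> (x, y) \<in> dual_conic c (r\<^sup>2) 0 (r\<^sup>2)" for x y
  proof -
    let ?X = "x - fst c" and ?Y = "y - snd c"
    have "(dist (x, y) c)\<^sup>2 = ?X\<^sup>2 + ?Y\<^sup>2"
      by (simp add: dist_prod_def dist_real_def)
    then have "(x, y) \<in> sphere c r \<longleftrightarrow> ?X\<^sup>2 + ?Y\<^sup>2 = r\<^sup>2"
      using assms by (metis dist_commute less_imp_le mem_sphere power2_eq_iff_nonneg zero_le_dist)
    also have "\<dots> \<longleftrightarrow> r\<^sup>2 * (?X\<^sup>2 + ?Y\<^sup>2) = r\<^sup>2 * r\<^sup>2"
      using r0 by (metis mult_cancel_left)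
    also have "\<dots> \<longleftrightarrow> (x, y) \<in> dual_conic c (r\<^sup>2) 0 (r\<^sup>2)"
      unfolding mem_dual_conic distrib_left by (rule arg_cong2[where f = "(=)"]) simp_all
    finally show ?thesis .
  qed
  then have "sphere c r = dual_conic c (r\<^sup>2) 0 (r\<^sup>2)" by auto
  then show ?thesis unfolding has_semi_axes_iff_dual_conic using assms
    by (intro conjI exI[of _ c] exI[of _ 1] exI[of _ 0]) simp_all
qed

text \<open>
  A circle through the vertices would be a circumscribed ellipse of eccentricity \<open>0 < \<tau>\<close>, so \<open>R\<close>
  is not even cyclic.
\<close>

lemma bielliptic_pos_class_imp_not_bicentric:
  assumes "bielliptic_of_class R \<tau>" "0 < \<tau>"
  shows "bielliptic R" "\<not> bicentric R"
proof -
  from assms obtain I O' where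
    m: "unique_min_eccentricity (inscribed R) I" "unique_min_eccentricity (circumscribed R) O'"
    "eccentricity I = \<tau>" "eccentricity O' = \<tau>" unfolding bielliptic_of_class_def by blast
  then show "bielliptic R" unfolding bielliptic_def by (intro exI[of _ I] exI[of _ O']) simp
  show "\<not> bicentric R"
  proof
    assume "bicentric R"
    then obtain c r where r: "0 < r" "\<forall>p. p extreme_point_of R \<longrightarrow> p \<in> sphere c r"
      unfolding bicentric_def cyclic_def by blast
    have s: "has_semi_axes (sphere c r) r r" using r sphere_has_semi_axes by blast
    then have "circumscribed R (sphere c r)" unfolding circumscribed_def ellipse_def using r by blast
    moreover have "eccentricity (sphere c r) = 0" using eccentricity_eq[OF s] r by simp
    moreover have "\<not> eccentricity E < eccentricity O'" if "circumscribed R E" for E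
      using m(2) that unfolding unique_min_eccentricity_def is_arg_min_def by blast
    ultimately show False using m(4) assms(2) by fastforce
  qed
qed

text \<open>
  The form in which minimality is checked below: every ellipse is a dual conic, so it suffices to
  compare anisotropies, and the strict inequality for all competitors also gives uniqueness.
\<close>

lemma unique_min_eccentricityI:
  assumes P0: "P (dual_conic c\<^sub>0 A\<^sub>0 B\<^sub>0 C\<^sub>0)" "pos_def A\<^sub>0 B\<^sub>0 C\<^sub>0"
    and ell: "\<And>E. P E \<Longrightarrow> ellipse E"
    and less: "\<And>c A B C. pos_def A B C \<Longrightarrow> P (dual_conic c A B C) \<Longrightarrow>
      dual_conic c A B C \<noteq> dual_conic c\<^sub>0 A\<^sub>0 B\<^sub>0 C\<^sub>0 \<Longrightarrow> anisotropy A\<^sub>0 B\<^sub>0 C\<^sub>0 < anisotropy A B C"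
  shows "unique_min_eccentricity P (dual_conic c\<^sub>0 A\<^sub>0 B\<^sub>0 C\<^sub>0)" (is "unique_min_eccentricity P ?E")
proof -
  have "eccentricity ?E < eccentricity E" if "P E" "E \<noteq> ?E" for E
  proof -
    obtain c A B C where E: "E = dual_conic c A B C" and pd: "pos_def A B C"
      by (rule ellipse_eq_dual_conic[OF ell[OF \<open>P E\<close>]])
    show ?thesis
      using less[OF pd] that unfolding E eccentricity_dual_conic_less_iff[OF P0(2) pd] .
  qed
  then show ?thesis
    unfolding unique_min_eccentricity_def is_arg_min_def using P0(1) by (blast dest: order_less_asym)
qed

section \<open>Support values of a dual conic\<close>

text \<open>
  An ellipse that lies in the strip \<open>\<bar>w \<bullet> p\<bar> \<le> 1\<close> and touches both of its boundary lines has its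
  centre on the axis of the strip, by central symmetry, and its squared support value \<open>w \<bullet> M w\<close>
  is \<open>1\<close>.
\<close>

lemma dual_conic_support:
  fixes w1 w2 :: real
  assumes pd: "pos_def A B C"
    and strip: "\<And>x y. (x, y) \<in> dual_conic c A B C \<Longrightarrow> \<bar>w1 * x + w2 * y\<bar> \<le> 1"
    and p: "(p1, p2) \<in> dual_conic c A B C" "w1 * p1 + w2 * p2 = 1"
    and q: "(q1, q2) \<in> dual_conic c A B C" "w1 * q1 + w2 * q2 = - 1"
  shows "w1 * fst c + w2 * snd c = 0" "A * w1\<^sup>2 + 2 * B * w1 * w2 + C * w2\<^sup>2 = 1"
proof -
  have sym: "(2 * fst c - x, 2 * snd c - y) \<in> dual_conic c A B C" if "(x, y) \<in> dual_conic c A B C" for x y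
    using that unfolding mem_dual_conic by (simp add: power2_commute algebra_simps)
  show c0: "w1 * fst c + w2 * snd c = 0"
    using strip[OF sym[OF p(1)]] strip[OF sym[OF q(1)]] p(2) q(2) by (simp add: algebra_simps)
  (* A touching point gives H \<ge> 1 by the Cauchy-Schwarz inequality for M. *)
  define H where "H = A * w1\<^sup>2 + 2 * B * w1 * w2 + C * w2\<^sup>2"
  define D where "D = A * C - B\<^sup>2"
  have D: "0 < D" using pd by (simp add: D_def pos_def_def)
  define X Y where "X = p1 - fst c" and "Y = p2 - snd c"
  have XY: "C * X\<^sup>2 - 2 * B * X * Y + A * Y\<^sup>2 = D" using p(1) by (simp add: mem_dual_conic X_def Y_def D_def)
  have w: "w1 * X + w2 * Y = 1" using p(2) c0 by (simp add: X_def Y_def algebra_simps)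
  have "H * (C * X\<^sup>2 - 2 * B * X * Y + A * Y\<^sup>2) - (A * C - B\<^sup>2) * (w1 * X + w2 * Y)\<^sup>2
      = ((A * w1 + B * w2) * Y - (B * w1 + C * w2) * X)\<^sup>2"
    unfolding H_def by algebra
  then have "0 \<le> (H - 1) * D" unfolding XY w by (simp add: D_def algebra_simps)
  then have H1: "1 \<le> H" using D by (simp add: zero_le_mult_iff)
  (* The point c + M w / sqrt H of the ellipse maximizes w; since it lies in the strip, H \<le> 1. *)
  define X' Y' where "X' = (A * w1 + B * w2) / sqrt H" and "Y' = (B * w1 + C * w2) / sqrt H"
  have scale: "C * (P / t)\<^sup>2 - 2 * B * (P / t) * (Q / t) + A * (Q / t)\<^sup>2
     = (C * P\<^sup>2 - 2 * B * P * Q + A * Q\<^sup>2) / t\<^sup>2" for P Q t :: real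
    by (simp add: power2_eq_square add_divide_distrib diff_divide_distrib mult.assoc)
  have "C * X'\<^sup>2 - 2 * B * X' * Y' + A * Y'\<^sup>2
     = (C * (A * w1 + B * w2)\<^sup>2 - 2 * B * (A * w1 + B * w2) * (B * w1 + C * w2) + A * (B * w1 + C * w2)\<^sup>2) / H"
    unfolding X'_def Y'_def scale using H1 by simp
  also have "C * (A * w1 + B * w2)\<^sup>2 - 2 * B * (A * w1 + B * w2) * (B * w1 + C * w2) + A * (B * w1 + C * w2)\<^sup>2
     = (A * C - B\<^sup>2) * H" unfolding H_def by algebra
  finally have "(X' + fst c, Y' + snd c) \<in> dual_conic c A B C"
    unfolding mem_dual_conic using H1 by simp
  from strip[OF this] have "\<bar>w1 * X' + w2 * Y'\<bar> \<le> 1" using c0 by (simp add: algebra_simps)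
  moreover have "w1 * X' + w2 * Y' = H / sqrt H"
    unfolding X'_def Y'_def H_def by (simp add: add_divide_distrib power2_eq_square algebra_simps)
  ultimately have "sqrt H \<le> 1" using H1 by (simp add: real_div_sqrt)
  then show "A * w1\<^sup>2 + 2 * B * w1 * w2 + C * w2\<^sup>2 = 1" using H1 unfolding H_def by simp
qed

section \<open>The parallelogram\<close>

definition corners :: "plane set" where
  "corners = {(3, 1), (1, 1), (-1, -1), (-3, -1)}"

definition para :: "plane set" where
  "para = convex hull corners"

lemma para_eq: "para = {(x, y) | x y. \<bar>x - 2 * y\<bar> \<le> 1 \<and> \<bar>y\<bar> \<le> 1}" (is "_ = ?P")
proof
  have "?P = {p. (1, -2) \<bullet> p \<le> 1} \<inter> {p. (1, -2) \<bullet> p \<ge> -1} \<inter> {p. (0, 1) \<bullet> p \<le> 1} \<inter> {p. (0, 1) \<bullet> p \<ge> -1}"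
    by (auto simp: abs_le_iff)
  then have "convex ?P"
    by (simp add: convex_Int convex_halfspace_le convex_halfspace_ge)
  moreover have "corners \<subseteq> ?P" by (auto simp: corners_def)
  ultimately show "para \<subseteq> ?P" unfolding para_def by (simp add: hull_minimal)
  show "?P \<subseteq> para"
  proof
    fix p assume "p \<in> ?P"
    then obtain x y where p: "p = (x, y)" and b: "\<bar>x - 2 * y\<bar> \<le> 1" "\<bar>y\<bar> \<le> 1" by blast
    (* In the coordinates s = x - 2 y and y the parallelogram is the square [-1, 1] x [-1, 1]; the
       weights of its corners are those of bilinear interpolation. *)
    define s where "s = x - 2 * y"
    define u where "u = (\<lambda>q::plane. if q = (3, 1) then (1 + s) * (1 + y) / 4 else
      if q = (1, 1) then (1 - s) * (1 + y) / 4 else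
      if q = (-1, -1) then (1 + s) * (1 - y) / 4 else (1 - s) * (1 - y) / 4)"
    have "\<forall>q\<in>corners. 0 \<le> u q" using b by (auto simp: u_def s_def abs_le_iff)
    moreover have "sum u corners = 1" by (simp add: corners_def u_def field_simps)
    moreover have "(\<Sum>q\<in>corners. u q *\<^sub>R q) = p"
      by (simp add: corners_def u_def p s_def field_simps)
    moreover have "finite corners" by (simp add: corners_def)
    ultimately show "p \<in> para" unfolding para_def convex_hull_finite[OF \<open>finite corners\<close>] by blast
  qed
qed

lemma extreme_points_para: "{p. p extreme_point_of para} = corners"
proof
  show "{p. p extreme_point_of para} \<subseteq> corners"
    unfolding para_def using extreme_point_of_convex_hull by blast
  (* The four corners are the points where x - 2 y = s and y = t for signs s and t. *)
  have ex: "(2 * t + s, t) extreme_point_of para" if st: "\<bar>s\<bar> = 1" "\<bar>t\<bar> = 1" for s t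
  proof -
    have "x1 = 2 * t + s \<and> y1 = t \<and> x2 = 2 * t + s \<and> y2 = t"
      if "(2 * t + s, t) \<in> open_segment (x1, y1) (x2, y2)"
        "\<bar>x1 - 2 * y1\<bar> \<le> 1" "\<bar>y1\<bar> \<le> 1" "\<bar>x2 - 2 * y2\<bar> \<le> 1" "\<bar>y2\<bar> \<le> 1" for x1 y1 x2 y2
    proof -
      from that(1) obtain u where u: "0 < u" "u < 1"
        and t: "t = (1 - u) * y1 + u * y2" and x: "2 * t + s = (1 - u) * x1 + u * x2"
        by (auto simp: in_segment)
      have s: "s = (1 - u) * (x1 - 2 * y1) + u * (x2 - 2 * y2)" using t x by (simp add: algebra_simps)
      have both: "a = e \<and> b = e"
        if "e = (1 - u) * a + u * b" "\<bar>e\<bar> = 1" "\<bar>a\<bar> \<le> 1" "\<bar>b\<bar> \<le> 1" for a b e :: real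
      proof -
        have ee: "e = 1 \<or> e = - 1" using that(2) by linarith
        have n: "0 \<le> 1 - e * a" "0 \<le> 1 - e * b" using ee that(3,4) by auto
        have "(1 - u) * (1 - e * a) + u * (1 - e * b) = 1 - e * ((1 - u) * a + u * b)"
          by (simp add: algebra_simps)
        also have "\<dots> = 0" using that(1) ee by auto
        finally have "(1 - u) * (1 - e * a) = 0" "u * (1 - e * b) = 0"
          using n u by (simp_all add: add_nonneg_eq_0_iff)
        then show ?thesis using u ee by auto
      qed
      show ?thesis using both[OF t st(2) that(3,5)] both[OF s st(1) that(2,4)] by auto
    qed
    then show ?thesis
      unfolding extreme_point_of_def para_eq using st by (fastforce simp: open_segment_def)
  qed
  show "corners \<subseteq> {p. p extreme_point_of para}"
    using ex[of 1 1] ex[of "-1" 1] ex[of 1 "-1"] ex[of "-1" "-1"] by (auto simp: corners_def)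
qed

lemma convex_quadrilateral_para: "convex_quadrilateral para"
  unfolding convex_quadrilateral_def extreme_points_para
  by (auto simp: para_def corners_def intro: polytope_convex_hull)

lemma edge_of_para_if_supporting:
  fixes w :: plane
  assumes "w \<noteq> 0" "\<And>p. p \<in> para \<Longrightarrow> w \<bullet> p \<le> 1"
    and "p \<in> corners" "q \<in> corners" "p \<noteq> q" "w \<bullet> p = 1" "w \<bullet> q = 1"
  shows "(para \<inter> {p. w \<bullet> p = 1}) edge_of para"
  unfolding edge_of_def
proof
  have "convex para" by (simp add: para_def)
  then show "(para \<inter> {p. w \<bullet> p = 1}) face_of para"
    by (rule face_of_Int_supporting_hyperplane_le) (use assms in auto)
  have "corners \<subseteq> para" unfolding para_def by (rule hull_subset)
  then have "aff_dim {p, q} \<le> aff_dim (para \<inter> {p. w \<bullet> p = 1})"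
    using assms by (intro aff_dim_subset) auto
  moreover have "aff_dim (para \<inter> {p. w \<bullet> p = 1}) \<le> aff_dim {p. w \<bullet> p = 1}"
    by (intro aff_dim_subset) auto
  ultimately show "aff_dim (para \<inter> {p. w \<bullet> p = 1}) = 1"
    using assms by (simp add: aff_dim_2 aff_dim_hyperplane)
qed

text \<open>
  An edge is spanned by some of the corners.  It contains no two opposite corners: otherwise it
  would contain the centre, which is interior to both diagonals, hence all corners, contradicting
  dimension one.  What remains are the four pairs of adjacent corners.
\<close>

lemma edge_of_para_cases:
  assumes "T edge_of para"
  shows "T \<in> {convex hull {(3, 1), (1, 1)}, convex hull {(-1, -1), (-3, -1)},
     convex hull {(3, 1), (-1, -1)}, convex hull {(1, 1), (-3, -1)}}"
proof -
  have T: "T face_of para" "aff_dim T = 1" using assms by (auto simp: edge_of_def)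
  have "compact corners" by (simp add: corners_def finite_imp_compact)
  then obtain S where S: "S \<subseteq> corners" "T = convex hull S"
    using face_of_convex_hull_subset T(1) unfolding para_def by metis
  have antip: False if "p \<in> S" "- p \<in> S" for p
  proof -
    have "midpoint p (- p) \<in> T" using that S(2) hull_subset[of S convex] face_of_imp_convex[OF T(1)]
      by (meson convex_contains_segment midpoint_in_closed_segment subsetD)
    then have 0: "0 \<in> T" by (simp add: midpoint_def)
    have "q \<in> T \<and> - q \<in> T" if "q \<in> corners" for q
    proof -
      have "0 = midpoint q (- q)" "q \<noteq> 0" using that by (auto simp: midpoint_def corners_def zero_prod_def)
      then have "0 \<in> open_segment q (- q)"
        by (metis midpoint_in_open_segment add.inverse_inverse midpoint_eq_endpoint(1))
      moreover have "q \<in> para" "- q \<in> para" using that by (auto simp: corners_def para_eq)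
      ultimately show ?thesis using T(1) 0 unfolding face_of_def by blast
    qed
    then have "corners \<subseteq> T" by blast
    then have "aff_dim {(3, 1), (1, 1), (-1, -1) :: plane} \<le> 1"
      using aff_dim_subset[of "{(3, 1), (1, 1), (-1, -1) :: plane}" T] T(2) by (auto simp: corners_def)
    moreover have "\<not> collinear {(3, 1), (1, 1), (-1, -1) :: plane}"
      by (auto simp: collinear_3_expand)
    ultimately show False by (simp add: collinear_aff_dim)
  qed
  have small: "S \<noteq> {}" "S \<noteq> {p}" for p using T(2) S(2) by auto
  have nm: "\<not> ((3, 1) \<in> S \<and> (-3, -1) \<in> S)" "\<not> ((1, 1) \<in> S \<and> (-1, -1) \<in> S)"
    using antip[of "(3, 1)"] antip[of "(1, 1)"] by auto
  have "S \<in> Pow corners" using S(1) by simp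
  then have "S \<in> {{(3, 1), (1, 1)}, {(-1, -1), (-3, -1)}, {(3, 1), (-1, -1)}, {(1, 1), (-3, -1)}}"
    using small nm by (auto simp: corners_def Pow_insert)
  then show ?thesis using S(2) by auto
qed

lemma affine_hull_side:
  assumes "p \<in> affine hull {q, r}" "w \<bullet> q = d" "w \<bullet> r = d"
  shows "w \<bullet> p = d"
proof -
  from assms(1) obtain u v where "p = u *\<^sub>R q + v *\<^sub>R r" "u + v = 1" by (auto simp: affine_hull_2)
  then show ?thesis using assms(2,3) by (simp add: inner_add_right flip: distrib_right)
qed

text \<open>
  Here \<open>w \<bullet> p' = d\<close> is an equation of the line through \<open>q\<close> and \<open>r\<close>, so tangency to the side is
  reduced to solving the equations of \<open>E\<close> and of this line.
\<close>

lemma tangent_to_convex_hull_side: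
  fixes q r w :: plane
  assumes "p \<in> closed_segment q r" "p \<in> E" "w \<bullet> q = d" "w \<bullet> r = d"
    and "\<And>p'. p' \<in> E \<Longrightarrow> w \<bullet> p' = d \<Longrightarrow> p' = p"
  shows "tangent_to_side E (convex hull {q, r})"
proof -
  have "p \<in> convex hull {q, r}" using assms(1) by (simp add: segment_convex_hull)
  moreover have "p \<in> affine hull {q, r}"
    using \<open>p \<in> convex hull {q, r}\<close> convex_hull_subset_affine_hull by blast
  ultimately show ?thesis unfolding tangent_to_side_def affine_hull_convex_hull
    using assms affine_hull_side by blast
qed

section \<open>The inscribed ellipse of minimal eccentricity\<close>

abbreviation E_in :: "plane set" where "E_in \<equiv> dual_conic 0 (7 / 3) (4 / 3) 1"

lemma E_in_pos_def: "pos_def (7 / 3) (4 / 3) 1"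
  by (simp add: pos_def_def power2_eq_square)

lemma E_in_anisotropy: "anisotropy (7 / 3) (4 / 3) 1 = 20"
  by (simp add: anisotropy_def power2_eq_square)

lemma mem_E_in: "(x, y) \<in> E_in \<longleftrightarrow> 9 * x\<^sup>2 - 24 * x * y + 21 * y\<^sup>2 = 5"
  by (auto simp: mem_dual_conic field_simps)

text \<open>
  Two decompositions of the equation into squares, one for each direction of sides, give both the
  containment and the tangency: the square of the side functional is at most \<open>1\<close>, with equality
  only where the other square vanishes.
\<close>

lemma inscribed_E_in: "inscribed para E_in"
proof -
  have sq: "9 * x\<^sup>2 - 24 * x * y + 21 * y\<^sup>2 = (3 * x - 4 * y)\<^sup>2 + 5 * y\<^sup>2"
    "9 * x\<^sup>2 - 24 * x * y + 21 * y\<^sup>2 = (2 * x - y)\<^sup>2 + 5 * (x - 2 * y)\<^sup>2" for x y :: real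
    by algebra+
  have "\<bar>y\<bar> \<le> 1 \<and> \<bar>x - 2 * y\<bar> \<le> 1" if "(x, y) \<in> E_in" for x y
  proof -
    have "(3 * x - 4 * y)\<^sup>2 + 5 * y\<^sup>2 = 5" "(2 * x - y)\<^sup>2 + 5 * (x - 2 * y)\<^sup>2 = 5"
      using that mem_E_in sq by metis+
    then have "y\<^sup>2 \<le> 1" "(x - 2 * y)\<^sup>2 \<le> 1"
      using zero_le_power2[of "3 * x - 4 * y"] zero_le_power2[of "2 * x - y"] by linarith+
    then show ?thesis by (simp add: abs_square_le_1)
  qed
  then have "E_in \<subseteq> para" by (auto simp: para_eq)
  moreover have horizontal: "3 * x = 4 * y" if "(x, y) \<in> E_in" "y\<^sup>2 = 1" for x y
    using that unfolding mem_E_in sq(1) by simp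
  have oblique: "2 * x = y" if "(x, y) \<in> E_in" "(x - 2 * y)\<^sup>2 = 1" for x y
    using that unfolding mem_E_in sq(2) by simp
  have "tangent_to_side E_in T" if "T edge_of para" for T
  proof -
    have seg: "p \<in> closed_segment q r" if "p = (1 - u) *\<^sub>R q + u *\<^sub>R r" "0 \<le> u" "u \<le> 1" for p q r :: plane and u
      using that by (auto simp: in_segment)
    have "tangent_to_side E_in (convex hull {(3, 1), (1, 1)})"
      by (rule tangent_to_convex_hull_side[where p = "(4 / 3, 1)" and w = "(0, 1)" and d = 1])
        (auto intro!: seg[where u = "5 / 6"] dest: horizontal simp: mem_E_in power2_eq_square)
    moreover have "tangent_to_side E_in (convex hull {(-1, -1), (-3, -1)})"
      by (rule tangent_to_convex_hull_side[where p = "(- 4 / 3, -1)" and w = "(0, 1)" and d = "-1"])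
        (auto intro!: seg[where u = "1 / 6"] dest: horizontal simp: mem_E_in power2_eq_square)
    moreover have "tangent_to_side E_in (convex hull {(3, 1), (-1, -1)})"
      by (rule tangent_to_convex_hull_side[where p = "(- 1 / 3, - 2 / 3)" and w = "(1, -2)" and d = 1])
        (auto intro!: seg[where u = "5 / 6"] dest: oblique simp: mem_E_in power2_eq_square)
    moreover have "tangent_to_side E_in (convex hull {(1, 1), (-3, -1)})"
      by (rule tangent_to_convex_hull_side[where p = "(1 / 3, 2 / 3)" and w = "(1, -2)" and d = "-1"])
        (auto intro!: seg[where u = "1 / 6"] dest: oblique simp: mem_E_in power2_eq_square)
    ultimately show ?thesis using edge_of_para_cases[OF that] by blast
  qed
  ultimately show ?thesis unfolding inscribed_def using ellipse_dual_conic[OF E_in_pos_def] by blast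
qed

lemma inscribed_para_meets_side:
  assumes "inscribed para E" "w \<noteq> 0" "\<And>p. p \<in> para \<Longrightarrow> w \<bullet> p \<le> 1"
    and "p \<in> corners" "q \<in> corners" "p \<noteq> q" "w \<bullet> p = 1" "w \<bullet> q = 1"
  obtains x y where "(x, y) \<in> E" "w \<bullet> (x, y) = 1"
proof -
  have "tangent_to_side E (para \<inter> {p. w \<bullet> p = 1})"
    using assms(1) edge_of_para_if_supporting[OF assms(2-8)] unfolding inscribed_def by blast
  then obtain p' where "p' \<in> E" "w \<bullet> p' = 1" unfolding tangent_to_side_def by blast
  then show ?thesis using that by (cases p') auto
qed

text \<open>
  The one-parameter family of inscribed ellipses: the support values at the side normals \<open>(0, 1)\<close>
  and \<open>(1, -2)\<close> are \<open>1\<close>, which are two linear equations for \<open>A, B, C\<close>.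
\<close>

lemma inscribed_para_dual_conic:
  assumes "pos_def A B C" "inscribed para (dual_conic c A B C)"
  shows "c = 0" "C = 1" "A = 4 * B - 3"
proof -
  have sub: "\<bar>y\<bar> \<le> 1" "\<bar>x - 2 * y\<bar> \<le> 1" if "(x, y) \<in> dual_conic c A B C" for x y
    using that assms(2) unfolding inscribed_def para_eq by auto
  obtain x1 y1 where 1: "(x1, y1) \<in> dual_conic c A B C" "(0, 1) \<bullet> (x1, y1) = 1"
    by (rule inscribed_para_meets_side[OF assms(2), of "(0, 1)" "(3, 1)" "(1, 1)"])
      (auto simp: para_eq corners_def zero_prod_def)
  obtain x2 y2 where 2: "(x2, y2) \<in> dual_conic c A B C" "(0, -1) \<bullet> (x2, y2) = 1"
    by (rule inscribed_para_meets_side[OF assms(2), of "(0, -1)" "(-3, -1)" "(-1, -1)"])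
      (auto simp: para_eq corners_def zero_prod_def)
  obtain x3 y3 where 3: "(x3, y3) \<in> dual_conic c A B C" "(1, -2) \<bullet> (x3, y3) = 1"
    by (rule inscribed_para_meets_side[OF assms(2), of "(1, -2)" "(3, 1)" "(-1, -1)"])
      (auto simp: para_eq corners_def zero_prod_def)
  obtain x4 y4 where 4: "(x4, y4) \<in> dual_conic c A B C" "(-1, 2) \<bullet> (x4, y4) = 1"
    by (rule inscribed_para_meets_side[OF assms(2), of "(-1, 2)" "(-3, -1)" "(1, 1)"])
      (auto simp: para_eq corners_def zero_prod_def)
  have h: "snd c = 0" "C = 1"
    using dual_conic_support[OF assms(1), of c 0 1 x1 y1 x2 y2] 1 2 sub by auto
  have o: "fst c - 2 * snd c = 0" "A - 4 * B + 4 * C = 1"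
    using dual_conic_support[OF assms(1), of c 1 "-2" x3 y3 x4 y4] 3 4 sub by auto
  show "c = 0" "C = 1" "A = 4 * B - 3" using h o by (auto simp: prod_eq_iff)
qed

text \<open>On the inscribed family \<open>(tr M)\<^sup>2 - 20 det M = (6 B - 8)\<^sup>2\<close>.\<close>

lemma unique_min_inscribed_para: "unique_min_eccentricity (inscribed para) E_in"
proof (rule unique_min_eccentricityI[where P = "inscribed para"])
  show "inscribed para E_in" by (rule inscribed_E_in)
  show "pos_def (7 / 3) (4 / 3) 1" by (rule E_in_pos_def)
  show "ellipse E" if "inscribed para E" for E using that by (simp add: inscribed_def)
next
  fix c A B C
  assume pd: "pos_def A B C" and ins: "inscribed para (dual_conic c A B C)" and ne: "dual_conic c A B C \<noteq> E_in"
  note e = inscribed_para_dual_conic[OF pd ins]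
  have "B \<noteq> 4 / 3"
  proof
    assume B: "B = 4 / 3"
    then have "A = 7 / 3" using e(3) by simp
    then show False using ne e(1,2) B by metis
  qed
  then have "0 < (6 * B - 8)\<^sup>2" by simp
  also have "(6 * B - 8)\<^sup>2 = (A + C)\<^sup>2 - 20 * (A * C - B\<^sup>2)"
    unfolding e by (simp add: power2_eq_square algebra_simps)
  finally show "anisotropy (7 / 3) (4 / 3) 1 < anisotropy A B C"
    unfolding E_in_anisotropy using pd by (simp add: anisotropy_def pos_def_def field_simps)
qed

section \<open>The circumscribed ellipse of minimal eccentricity\<close>

abbreviation E_out :: "plane set" where "E_out \<equiv> dual_conic 0 (54 / 5) (12 / 5) (6 / 5)"

lemma E_out_pos_def: "pos_def (54 / 5) (12 / 5) (6 / 5)"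
  by (simp add: pos_def_def power2_eq_square)

lemma E_out_anisotropy: "anisotropy (54 / 5) (12 / 5) (6 / 5) = 20"
  by (simp add: anisotropy_def power2_eq_square)

lemma circumscribed_para_iff:
  "circumscribed para E \<longleftrightarrow> ellipse E \<and> corners \<subseteq> E"
  unfolding circumscribed_def using extreme_points_para by blast

text \<open>
  Subtracting the equations at opposite corners \<open>p\<close> and \<open>-p\<close> shows that the centre is conjugate
  to \<open>p\<close>; for two independent \<open>p\<close> this forces the centre to be \<open>0\<close>.  The equations at \<open>(3, 1)\<close>
  and \<open>(1, 1)\<close> then leave a one-parameter family.
\<close>

lemma circumscribed_para_dual_conic:
  assumes pd: "pos_def A B C" and circ: "circumscribed para (dual_conic c A B C)"
  shows "c = 0" "B = 2 * C" "A = (A * C - B\<^sup>2) + 3 * C"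
proof -
  obtain h k where c: "c = (h, k)" by (cases c)
  have on: "(3, 1) \<in> dual_conic c A B C" "(1, 1) \<in> dual_conic c A B C"
    "(-1, -1) \<in> dual_conic c A B C" "(-3, -1) \<in> dual_conic c A B C"
    using circ by (auto simp: circumscribed_para_iff corners_def)
  note eqs = on[unfolded mem_dual_conic c fst_conv snd_conv]
  have "C * h - B * k = 0" "A * k - B * h = 0"
    using eqs by (simp_all add: power2_eq_square algebra_simps)
  then have "(A * C - B\<^sup>2) * h = 0" "(A * C - B\<^sup>2) * k = 0" by algebra+
  then have hk: "h = 0" "k = 0" using pd by (auto simp: pos_def_def)
  then show "c = 0" by (simp add: c zero_prod_def)
  show "B = 2 * C" "A = (A * C - B\<^sup>2) + 3 * C" using eqs(1,2) unfolding hk by simp_all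
qed

lemma circumscribed_E_out: "circumscribed para E_out"
  unfolding circumscribed_para_iff using ellipse_dual_conic[OF E_out_pos_def]
  by (simp add: corners_def mem_dual_conic power2_eq_square)

text \<open>
  On the circumscribed family, with \<open>D = det M\<close>, the relation \<open>D (C - 1) = C\<^sup>2\<close> gives
  \<open>(tr M)\<^sup>2 - 20 D = (D - 6 C)\<^sup>2\<close>.
\<close>

lemma unique_min_circumscribed_para: "unique_min_eccentricity (circumscribed para) E_out"
proof (rule unique_min_eccentricityI[where P = "circumscribed para"])
  show "circumscribed para E_out" by (rule circumscribed_E_out)
  show "pos_def (54 / 5) (12 / 5) (6 / 5)" by (rule E_out_pos_def)
  show "ellipse E" if "circumscribed para E" for E using that by (simp add: circumscribed_def)
next
  fix c A B C
  assume pd: "pos_def A B C" and circ: "circumscribed para (dual_conic c A B C)" and ne: "dual_conic c A B C \<noteq> E_out"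
  note e = circumscribed_para_dual_conic[OF pd circ]
  define D where "D = A * C - B\<^sup>2"
  have D: "0 < D" "0 < C" using pd by (auto simp: D_def pos_def_def)
  have A: "A = D + 3 * C" using e(3) by (simp add: D_def)
  have DC: "D * (C - 1) = C\<^sup>2" using D_def unfolding A e(2) by (simp add: power2_eq_square algebra_simps)
  have "D \<noteq> 6 * C"
  proof
    assume D6: "D = 6 * C"
    then have "C * (5 * C - 6) = 0" using DC by (simp add: power2_eq_square algebra_simps)
    then have "C = 6 / 5" using D by simp
    moreover have "B = 12 / 5" "A = 54 / 5" using \<open>C = 6 / 5\<close> e(2) A D6 by simp_all
    ultimately show False using ne e(1) by metis
  qed
  then have "0 < (D - 6 * C)\<^sup>2" by simp
  also have "(D - 6 * C)\<^sup>2 = (A + C)\<^sup>2 - 20 * D"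
    unfolding A using DC by (simp add: power2_eq_square algebra_simps)
  finally show "anisotropy (54 / 5) (12 / 5) (6 / 5) < anisotropy A B C"
    unfolding E_out_anisotropy using D by (simp add: anisotropy_def field_simps flip: D_def)
qed

section \<open>A bielliptic quadrilateral of positive class\<close>

theorem theorem4:
  "(\<exists>R. convex_quadrilateral R \<and> (\<exists>\<tau>>0. bielliptic_of_class R \<tau>)) \<and>
   (\<exists>R. convex_quadrilateral R \<and> bielliptic R \<and> \<not> bicentric R)"
proof -
  define \<tau> where "\<tau> = eccentricity E_in"
  have "eccentricity E_out = \<tau>" unfolding \<tau>_def
    by (rule eccentricity_dual_conic_eq[OF E_out_pos_def E_in_pos_def])
      (simp only: E_out_anisotropy E_in_anisotropy)
  moreover have "0 < \<tau>" "\<tau> < 1"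
    unfolding \<tau>_def using eccentricity_dual_conic_pos[OF E_in_pos_def] E_in_anisotropy
      eccentricity_less_1[OF ellipse_dual_conic[OF E_in_pos_def]] by simp_all
  ultimately have "bielliptic_of_class para \<tau>" "0 < \<tau>"
    unfolding bielliptic_of_class_def
    using unique_min_inscribed_para unique_min_circumscribed_para \<tau>_def by auto
  then show ?thesis
    using convex_quadrilateral_para bielliptic_pos_class_imp_not_bicentric by blast
qed

end
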